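(* Let $(\mathfrak g,\mathfrak g_r^* )$ be a quasi-triangular mock-pre-Lie bialgebra induced by $r\in\mathfrak g\otimes\mathfrak g$. Then $r_+:(\mathfrak g^*,\cdot_+)\to(\mathfrak g,\cdot_{\mathfrak g})$ is a relative Rota-Baxter operator of weight $-1$ with respect to the action $(-L^*-R^*,R^* )$ of $(\mathfrak g,\cdot_{\mathfrak g})$ on $(\mathfrak g^*,\cdot_+)$, where $\xi\cdot_+\eta=R^*_{I(\eta)}\xi$ with $I=r_+-r_-$.
   Context: All vector spaces are finite-dimensional over an algebraically closed field $\mathbb K$ of characteristic $0$. A mock-pre-Lie algebra is a vector space with a bilinear product satisfying $(x\cdot y)\cdot z+x\cdot(y\cdot z)=-(y\cdot x)\cdot z-y\cdot(x\cdot z)$. Write $\{x,y\}_c=x\cdot_{\mathfrak g}y+y\cdot_{\mathfrak g}x$, $L_xy=x\cdot_{\mathfrak g}y$, $R_xy=y\cdot_{\mathfrak g}x$, and define $L_x^*,R_x^*$ on $\mathfrak g^*$ by $\langle L_x^*\xi,y\rangle=-\langle\xi,x\cdot_{\mathfrak g}y\rangle$, $\langle R_x^*\xi,y\rangle=-\langle\xi,y\cdot_{\mathfrak g}x\rangle$. For $r\in\mathfrak g\otimes\mathfrak g$ define $r_\pm:\mathfrak g^*\to\mathfrak g$ by $\langle r_+(\xi),\eta\rangle=r(\xi,\eta)$, $\langle r_-(\xi),\eta\rangle=r(\eta,\xi)$ (so for $r=\sum a_i\otimes b_i$, $r_+(\xi)=\sum\langle\xi,a_i\rangle b_i$), and $I=r_+-r_-$.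 For $r=\sum_ia_i\otimes b_i$ let $$[[r,r]]=\sum_{i,j}\big(-a_i\cdot_{\mathfrak g}a_j\otimes b_j\otimes b_i-b_j\otimes a_i\cdot_{\mathfrak g}a_j\otimes b_i+a_j\otimes\{a_i,b_j\}_c\otimes b_i+\{a_i,b_j\}_c\otimes a_j\otimes b_i-a_i\otimes a_j\otimes\{b_i,b_j\}_c\big).$$ An element $s\in\mathfrak g\otimes\mathfrak g$ is $(L,L+R)$-invariant if $(L_x\otimes\mathrm{Id}-\mathrm{Id}\otimes(L_x+R_x))s=0$ for all $x$. $r$ induces on $\mathfrak g^*$ the product $\xi\cdot_r\eta=-(L^*_{r_+(\xi)}+R^*_{r_+(\xi)})\eta+R^*_{r_-(\eta)}\xi$, dual to $\alpha(x)=(\mathrm{Id}\otimes R_x+\mathrm{Id}\otimes L_x-L_x\otimes\mathrm{Id})r$; write $\mathfrak g_r^*=(\mathfrak g^*,\cdot_r)$. If $[[r,r]]=0$ and the skew-symmetric part $r_a$ of $r$ is $(L,L+R)$-invariant, then $(\mathfrak g,\mathfrak g_r^* )$ is a mock-pre-Lie bialgebra, called the quasi-triangular mock-pre-Lie bialgebra induced by $r$ (so "quasi-triangular" means these two conditions on $r$). In this case $(\mathfrak g^*,\cdot_+)$ is a mock-pre-Lie algebra. A representation of a mock-pre-Lie algebra $(\mathfrak g,\cdot_{\mathfrak g})$ on $V$ is a pair of linear maps $\rho,\mu:\mathfrak g\to\mathfrak{gl}(V)$ with $\rho(\{x,y\}_c)=-\rho(x)\rho(y)-\rho(y)\rho(x)$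 and $\rho(x)\mu(y)+\mu(y)\rho(x)=-\mu(x\cdot_{\mathfrak g}y)-\mu(y)\mu(x)$. It is an action of $(\mathfrak g,\cdot_{\mathfrak g})$ on a mock-pre-Lie algebra $(\mathfrak h,\cdot_{\mathfrak h})$ if $V=\mathfrak h$ and for all $x\in\mathfrak g$, $u,v\in\mathfrak h$: $\mu(x)(u\cdot_{\mathfrak h}v)+u\cdot_{\mathfrak h}(\mu(x)v)+v\cdot_{\mathfrak h}(\mu(x)u)+\mu(x)(v\cdot_{\mathfrak h}u)=0$ and $(\mu(x)u)\cdot_{\mathfrak h}v+u\cdot_{\mathfrak h}(\rho(x)v)+(\rho(x)u)\cdot_{\mathfrak h}v+\rho(x)(u\cdot_{\mathfrak h}v)=0$. A relative Rota-Baxter operator of weight $\lambda$ from $\mathfrak h$ to $\mathfrak g$ with respect to an action $(\rho,\mu)$ of $\mathfrak g$ on $\mathfrak h$ is a linear map $B:\mathfrak h\to\mathfrak g$ with $(Bu)\cdot_{\mathfrak g}(Bv)=B(\rho(Bu)v+\mu(Bv)u+\lambda u\cdot_{\mathfrak h}v)$ for all $u,v\in\mathfrak h$. *)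

theory Defs
  imports "HOL-Computational_Algebra.Polynomial" "HOL-Library.Function_Algebras"
begin

section \<open>Finite-dimensional spaces and linear maps\<close>

text \<open>
  The space \<open>\<gg>\<close> is a whole type, with scalar multiplication \<open>s\<close>; its dual is only a subspace of the
  type of all functions from \<open>\<gg>\<close> to the ground field.  Algebraic structures are therefore relative to
  a subspace \<open>V\<close> of an ambient vector space.
\<close>

definition fin_dim_space :: "('k::field \<Rightarrow> 'v::ab_group_add \<Rightarrow> 'v) \<Rightarrow> 'v set \<Rightarrow> bool" where
  "fin_dim_space s V \<longleftrightarrow>
     vector_space s \<and> module.subspace s V \<and> (\<exists>B. finite B \<and> module.span s B = V)"

definition linear_on :: "('k::field \<Rightarrow> 'v::ab_group_add \<Rightarrow> 'v) \<Rightarrow> 'v set \<Rightarrow>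
    ('k \<Rightarrow> 'w::ab_group_add \<Rightarrow> 'w) \<Rightarrow> 'w set \<Rightarrow> ('v \<Rightarrow> 'w) \<Rightarrow> bool" where
  "linear_on s V t W f \<longleftrightarrow>
     (\<forall>x\<in>V. f x \<in> W) \<and>
     (\<forall>x\<in>V. \<forall>y\<in>V. f (x + y) = f x + f y) \<and>
     (\<forall>c. \<forall>x\<in>V. f (s c x) = t c (f x))"


section \<open>Mock-pre-Lie algebras, representations, actions, Rota-Baxter operators\<close>

definition mock_pre_Lie_algebra :: "('k::field \<Rightarrow> 'v::ab_group_add \<Rightarrow> 'v) \<Rightarrow> 'v set \<Rightarrow>
    ('v \<Rightarrow> 'v \<Rightarrow> 'v) \<Rightarrow> bool" where
  "mock_pre_Lie_algebra s V m \<longleftrightarrow>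
     fin_dim_space s V \<and>
     (\<forall>x\<in>V. linear_on s V s V (m x)) \<and>
     (\<forall>y\<in>V. linear_on s V s V (\<lambda>x. m x y)) \<and>
     (\<forall>x\<in>V. \<forall>y\<in>V. \<forall>z\<in>V. m (m x y) z + m x (m y z) = - m (m y x) z - m y (m x z))"

definition anticomm :: "('v \<Rightarrow> 'v \<Rightarrow> 'v::plus) \<Rightarrow> 'v \<Rightarrow> 'v \<Rightarrow> 'v" where
  "anticomm m x y = m x y + m y x"

definition mock_pre_Lie_rep :: "('k::field \<Rightarrow> 'g::ab_group_add \<Rightarrow> 'g) \<Rightarrow> 'g set \<Rightarrow> ('g \<Rightarrow> 'g \<Rightarrow> 'g) \<Rightarrow>
    ('k \<Rightarrow> 'v::ab_group_add \<Rightarrow> 'v) \<Rightarrow> 'v set \<Rightarrow> ('g \<Rightarrow> 'v \<Rightarrow> 'v) \<Rightarrow> ('g \<Rightarrow> 'v \<Rightarrow> 'v) \<Rightarrow> bool" where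
  "mock_pre_Lie_rep s G m t V \<rho> \<mu> \<longleftrightarrow>
     mock_pre_Lie_algebra s G m \<and> fin_dim_space t V \<and>
     (\<forall>x\<in>G. linear_on t V t V (\<rho> x)) \<and> (\<forall>v\<in>V. linear_on s G t V (\<lambda>x. \<rho> x v)) \<and>
     (\<forall>x\<in>G. linear_on t V t V (\<mu> x)) \<and> (\<forall>v\<in>V. linear_on s G t V (\<lambda>x. \<mu> x v)) \<and>
     (\<forall>x\<in>G. \<forall>y\<in>G. \<forall>v\<in>V. \<rho> (anticomm m x y) v = - \<rho> x (\<rho> y v) - \<rho> y (\<rho> x v)) \<and>
     (\<forall>x\<in>G. \<forall>y\<in>G. \<forall>v\<in>V. \<rho> x (\<mu> y v) + \<mu> y (\<rho> x v) = - \<mu> (m x y) v - \<mu> y (\<mu> x v))"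

definition mock_pre_Lie_action :: "('k::field \<Rightarrow> 'g::ab_group_add \<Rightarrow> 'g) \<Rightarrow> 'g set \<Rightarrow> ('g \<Rightarrow> 'g \<Rightarrow> 'g) \<Rightarrow>
    ('k \<Rightarrow> 'h::ab_group_add \<Rightarrow> 'h) \<Rightarrow> 'h set \<Rightarrow> ('h \<Rightarrow> 'h \<Rightarrow> 'h) \<Rightarrow>
    ('g \<Rightarrow> 'h \<Rightarrow> 'h) \<Rightarrow> ('g \<Rightarrow> 'h \<Rightarrow> 'h) \<Rightarrow> bool" where
  "mock_pre_Lie_action s G m t H n \<rho> \<mu> \<longleftrightarrow>
     mock_pre_Lie_algebra t H n \<and> mock_pre_Lie_rep s G m t H \<rho> \<mu> \<and>
     (\<forall>x\<in>G. \<forall>u\<in>H. \<forall>v\<in>H. \<mu> x (n u v) + n u (\<mu> x v) + n v (\<mu> x u) + \<mu> x (n v u) = 0) \<and>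
     (\<forall>x\<in>G. \<forall>u\<in>H. \<forall>v\<in>H. n (\<mu> x u) v + n u (\<rho> x v) + n (\<rho> x u) v + \<rho> x (n u v) = 0)"

definition relative_Rota_Baxter :: "'k \<Rightarrow> ('k::field \<Rightarrow> 'h::ab_group_add \<Rightarrow> 'h) \<Rightarrow> 'h set \<Rightarrow>
    ('h \<Rightarrow> 'h \<Rightarrow> 'h) \<Rightarrow> ('k \<Rightarrow> 'g::ab_group_add \<Rightarrow> 'g) \<Rightarrow> 'g set \<Rightarrow> ('g \<Rightarrow> 'g \<Rightarrow> 'g) \<Rightarrow>
    ('g \<Rightarrow> 'h \<Rightarrow> 'h) \<Rightarrow> ('g \<Rightarrow> 'h \<Rightarrow> 'h) \<Rightarrow> ('h \<Rightarrow> 'g) \<Rightarrow> bool" where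
  "relative_Rota_Baxter w t H n s G m \<rho> \<mu> B \<longleftrightarrow>
     mock_pre_Lie_action s G m t H n \<rho> \<mu> \<and> linear_on t H s G B \<and>
     (\<forall>u\<in>H. \<forall>v\<in>H. m (B u) (B v) = B (\<rho> (B u) v + \<mu> (B v) u + t w (n u v)))"


section \<open>The dual space and the dual operators\<close>

definition dual :: "('k::field \<Rightarrow> 'g::ab_group_add \<Rightarrow> 'g) \<Rightarrow> ('g \<Rightarrow> 'k) set" where
  "dual s = {\<xi>. Vector_Spaces.linear s (*) \<xi>}"

definition dual_scale :: "'k::field \<Rightarrow> ('g \<Rightarrow> 'k) \<Rightarrow> 'g \<Rightarrow> 'k" where
  "dual_scale c \<xi> = (\<lambda>x. c * \<xi> x)"

definition L_star :: "('g \<Rightarrow> 'g \<Rightarrow> 'g) \<Rightarrow> 'g \<Rightarrow> ('g \<Rightarrow> 'k::field) \<Rightarrow> 'g \<Rightarrow> 'k" where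
  "L_star m x \<xi> = (\<lambda>y. - \<xi> (m x y))"

definition R_star :: "('g \<Rightarrow> 'g \<Rightarrow> 'g) \<Rightarrow> 'g \<Rightarrow> ('g \<Rightarrow> 'k::field) \<Rightarrow> 'g \<Rightarrow> 'k" where
  "R_star m x \<xi> = (\<lambda>y. - \<xi> (m y x))"


section \<open>Tensors\<close>

text \<open>
  \<open>\<gg> \<otimes> \<gg>\<close> and \<open>\<gg> \<otimes> \<gg> \<otimes> \<gg>\<close> are realised inside the multilinear forms on the dual, where
  \<open>a \<otimes> b\<close> is the form \<open>(\<xi>, \<eta>) \<mapsto> \<xi>(a) \<eta>(b)\<close>; this is faithful because linear functionals separate points.
  All forms are set to \<open>0\<close> on functions that are not linear functionals, so that equality of tensors
  is equality of HOL functions.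
\<close>

definition form2 :: "('k::field \<Rightarrow> 'g::ab_group_add \<Rightarrow> 'g) \<Rightarrow>
    (('g \<Rightarrow> 'k) \<Rightarrow> ('g \<Rightarrow> 'k) \<Rightarrow> 'k) \<Rightarrow> ('g \<Rightarrow> 'k) \<Rightarrow> ('g \<Rightarrow> 'k) \<Rightarrow> 'k" where
  "form2 s F = (\<lambda>\<xi> \<eta>. if \<xi> \<in> dual s \<and> \<eta> \<in> dual s then F \<xi> \<eta> else 0)"

definition form3 :: "('k::field \<Rightarrow> 'g::ab_group_add \<Rightarrow> 'g) \<Rightarrow>
    (('g \<Rightarrow> 'k) \<Rightarrow> ('g \<Rightarrow> 'k) \<Rightarrow> ('g \<Rightarrow> 'k) \<Rightarrow> 'k) \<Rightarrow>
    ('g \<Rightarrow> 'k) \<Rightarrow> ('g \<Rightarrow> 'k) \<Rightarrow> ('g \<Rightarrow> 'k) \<Rightarrow> 'k" where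
  "form3 s F = (\<lambda>\<xi> \<eta> \<zeta>. if \<xi> \<in> dual s \<and> \<eta> \<in> dual s \<and> \<zeta> \<in> dual s then F \<xi> \<eta> \<zeta> else 0)"

definition pure2 :: "('k::field \<Rightarrow> 'g::ab_group_add \<Rightarrow> 'g) \<Rightarrow> 'g \<Rightarrow> 'g \<Rightarrow>
    ('g \<Rightarrow> 'k) \<Rightarrow> ('g \<Rightarrow> 'k) \<Rightarrow> 'k" where
  "pure2 s a b = form2 s (\<lambda>\<xi> \<eta>. \<xi> a * \<eta> b)"

definition pure3 :: "('k::field \<Rightarrow> 'g::ab_group_add \<Rightarrow> 'g) \<Rightarrow> 'g \<Rightarrow> 'g \<Rightarrow> 'g \<Rightarrow>
    ('g \<Rightarrow> 'k) \<Rightarrow> ('g \<Rightarrow> 'k) \<Rightarrow> ('g \<Rightarrow> 'k) \<Rightarrow> 'k" where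
  "pure3 s a b c = form3 s (\<lambda>\<xi> \<eta> \<zeta>. \<xi> a * \<eta> b * \<zeta> c)"

text \<open>The list \<open>[(a\<^sub>1, b\<^sub>1), \<dots>]\<close> presents the tensor \<open>\<Sum>\<^sub>i a\<^sub>i \<otimes> b\<^sub>i\<close>; scalars are absorbed into the \<open>a\<^sub>i\<close>.\<close>

definition tensor_of :: "('k::field \<Rightarrow> 'g::ab_group_add \<Rightarrow> 'g) \<Rightarrow> ('g \<times> 'g) list \<Rightarrow>
    ('g \<Rightarrow> 'k) \<Rightarrow> ('g \<Rightarrow> 'k) \<Rightarrow> 'k" where
  "tensor_of s ps = (\<Sum>(a, b)\<leftarrow>ps. pure2 s a b)"

definition tensors :: "('k::field \<Rightarrow> 'g::ab_group_add \<Rightarrow> 'g) \<Rightarrow> (('g \<Rightarrow> 'k) \<Rightarrow> ('g \<Rightarrow> 'k) \<Rightarrow> 'k) set" where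
  "tensors s = range (tensor_of s)"

text \<open>\<open>(f \<otimes> g) r\<close>, for linear \<open>f\<close> and \<open>g\<close>; see \<open>map2_tensor_of\<close> below.\<close>

definition map2 :: "('k::field \<Rightarrow> 'g::ab_group_add \<Rightarrow> 'g) \<Rightarrow> ('g \<Rightarrow> 'g) \<Rightarrow> ('g \<Rightarrow> 'g) \<Rightarrow>
    (('g \<Rightarrow> 'k) \<Rightarrow> ('g \<Rightarrow> 'k) \<Rightarrow> 'k) \<Rightarrow> ('g \<Rightarrow> 'k) \<Rightarrow> ('g \<Rightarrow> 'k) \<Rightarrow> 'k" where
  "map2 s f g r = form2 s (\<lambda>\<xi> \<eta>. r (\<xi> \<circ> f) (\<eta> \<circ> g))"

definition skew_part :: "(('g \<Rightarrow> 'k) \<Rightarrow> ('g \<Rightarrow> 'k) \<Rightarrow> 'k::field) \<Rightarrow> ('g \<Rightarrow> 'k) \<Rightarrow> ('g \<Rightarrow> 'k) \<Rightarrow> 'k" where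
  "skew_part r = (\<lambda>\<xi> \<eta>. (r \<xi> \<eta> - r \<eta> \<xi>) / 2)"

definition r_plus :: "('k::field \<Rightarrow> 'g::ab_group_add \<Rightarrow> 'g) \<Rightarrow> (('g \<Rightarrow> 'k) \<Rightarrow> ('g \<Rightarrow> 'k) \<Rightarrow> 'k) \<Rightarrow>
    ('g \<Rightarrow> 'k) \<Rightarrow> 'g" where
  "r_plus s r \<xi> = (THE x. \<forall>\<eta>\<in>dual s. \<eta> x = r \<xi> \<eta>)"

definition r_minus :: "('k::field \<Rightarrow> 'g::ab_group_add \<Rightarrow> 'g) \<Rightarrow> (('g \<Rightarrow> 'k) \<Rightarrow> ('g \<Rightarrow> 'k) \<Rightarrow> 'k) \<Rightarrow>
    ('g \<Rightarrow> 'k) \<Rightarrow> 'g" where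
  "r_minus s r \<xi> = (THE x. \<forall>\<eta>\<in>dual s. \<eta> x = r \<eta> \<xi>)"

definition I_map :: "('k::field \<Rightarrow> 'g::ab_group_add \<Rightarrow> 'g) \<Rightarrow> (('g \<Rightarrow> 'k) \<Rightarrow> ('g \<Rightarrow> 'k) \<Rightarrow> 'k) \<Rightarrow>
    ('g \<Rightarrow> 'k) \<Rightarrow> 'g" where
  "I_map s r \<xi> = r_plus s r \<xi> - r_minus s r \<xi>"

definition plus_product :: "('k::field \<Rightarrow> 'g::ab_group_add \<Rightarrow> 'g) \<Rightarrow> ('g \<Rightarrow> 'g \<Rightarrow> 'g) \<Rightarrow>
    (('g \<Rightarrow> 'k) \<Rightarrow> ('g \<Rightarrow> 'k) \<Rightarrow> 'k) \<Rightarrow> ('g \<Rightarrow> 'k) \<Rightarrow> ('g \<Rightarrow> 'k) \<Rightarrow> 'g \<Rightarrow> 'k" where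
  "plus_product s m r \<xi> \<eta> = R_star m (I_map s r \<eta>) \<xi>"

definition bracket_of :: "('k::field \<Rightarrow> 'g::ab_group_add \<Rightarrow> 'g) \<Rightarrow> ('g \<Rightarrow> 'g \<Rightarrow> 'g) \<Rightarrow> ('g \<times> 'g) list \<Rightarrow>
    ('g \<Rightarrow> 'k) \<Rightarrow> ('g \<Rightarrow> 'k) \<Rightarrow> ('g \<Rightarrow> 'k) \<Rightarrow> 'k" where
  "bracket_of s m ps =
     (\<Sum>(a\<^sub>i, b\<^sub>i)\<leftarrow>ps. \<Sum>(a\<^sub>j, b\<^sub>j)\<leftarrow>ps.
        - pure3 s (m a\<^sub>i a\<^sub>j) b\<^sub>j b\<^sub>i
        - pure3 s b\<^sub>j (m a\<^sub>i a\<^sub>j) b\<^sub>i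
        + pure3 s a\<^sub>j (anticomm m a\<^sub>i b\<^sub>j) b\<^sub>i
        + pure3 s (anticomm m a\<^sub>i b\<^sub>j) a\<^sub>j b\<^sub>i
        - pure3 s a\<^sub>i a\<^sub>j (anticomm m b\<^sub>i b\<^sub>j))"

text \<open>
  \<open>[[r, r]]\<close>, computed from some presentation of \<open>r\<close>; by \<open>bracket_tensor_of\<close> below, the
  presentation is irrelevant.
\<close>

definition bracket :: "('k::field \<Rightarrow> 'g::ab_group_add \<Rightarrow> 'g) \<Rightarrow> ('g \<Rightarrow> 'g \<Rightarrow> 'g) \<Rightarrow>
    (('g \<Rightarrow> 'k) \<Rightarrow> ('g \<Rightarrow> 'k) \<Rightarrow> 'k) \<Rightarrow> ('g \<Rightarrow> 'k) \<Rightarrow> ('g \<Rightarrow> 'k) \<Rightarrow> ('g \<Rightarrow> 'k) \<Rightarrow> 'k" where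
  "bracket s m r = bracket_of s m (SOME ps. tensor_of s ps = r)"

definition L_LR_invariant :: "('k::field \<Rightarrow> 'g::ab_group_add \<Rightarrow> 'g) \<Rightarrow> ('g \<Rightarrow> 'g \<Rightarrow> 'g) \<Rightarrow>
    (('g \<Rightarrow> 'k) \<Rightarrow> ('g \<Rightarrow> 'k) \<Rightarrow> 'k) \<Rightarrow> bool" where
  "L_LR_invariant s m r \<longleftrightarrow> (\<forall>x. map2 s (m x) id r - map2 s id (\<lambda>y. m x y + m y x) r = 0)"

text \<open>
  The conditions on \<open>r \<in> \<gg> \<otimes> \<gg>\<close> under which it induces a quasi-triangular mock-pre-Lie bialgebra
  \<open>(\<gg>, \<gg>\<^sup>*\<^sub>r)\<close>; that \<open>\<gg>\<close> is mock-pre-Lie is assumed separately.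
\<close>

definition quasi_triangular :: "('k::field \<Rightarrow> 'g::ab_group_add \<Rightarrow> 'g) \<Rightarrow> ('g \<Rightarrow> 'g \<Rightarrow> 'g) \<Rightarrow>
    (('g \<Rightarrow> 'k) \<Rightarrow> ('g \<Rightarrow> 'k) \<Rightarrow> 'k) \<Rightarrow> bool" where
  "quasi_triangular s m r \<longleftrightarrow>
     bracket s m r = 0 \<and> L_LR_invariant s m (skew_part r)"


section \<open>The definitions do not depend on the presentation of a tensor\<close>

lemma dual_add: "\<xi> \<in> dual s \<Longrightarrow> \<xi> (x + y) = \<xi> x + \<xi> y"
  and dual_scale_apply: "\<xi> \<in> dual s \<Longrightarrow> \<xi> (s c x) = c * \<xi> x"
  and dual_zero: "\<xi> \<in> dual s \<Longrightarrow> \<xi> 0 = 0"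
proof -
  show add: "\<xi> (x + y) = \<xi> x + \<xi> y" if "\<xi> \<in> dual s" for x y
    using that by (simp add: dual_def Vector_Spaces.linear_iff)
  show "\<xi> (s c x) = c * \<xi> x" if "\<xi> \<in> dual s"
    using that by (simp add: dual_def Vector_Spaces.linear_iff)
  show "\<xi> 0 = 0" if "\<xi> \<in> dual s"
    using add[OF that, of 0 0] by (metis add.right_neutral add_left_cancel)
qed

lemma dual_sum_list: "\<xi> \<in> dual s \<Longrightarrow> \<xi> (\<Sum>p\<leftarrow>ps. f p) = (\<Sum>p\<leftarrow>ps. \<xi> (f p))"
  by (induction ps) (simp_all add: dual_add dual_zero)

lemma dual_separates:
  assumes "vector_space s" "\<And>\<xi>. \<xi> \<in> dual s \<Longrightarrow> \<xi> x = \<xi> y"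
  shows "x = y"
proof (rule ccontr)
  assume "x \<noteq> y"
  have vk: "vector_space ((*) :: 'a \<Rightarrow> 'a \<Rightarrow> 'a)"
    by unfold_locales (simp_all add: algebra_simps)
  interpret p: vector_space_pair s "(*) :: 'a \<Rightarrow> 'a \<Rightarrow> 'a"
    using assms(1) vk by (rule vector_space_pair.intro)
  have "\<not> p.vs1.dependent {x - y}"
    using \<open>x \<noteq> y\<close> p.vs1.dependent_single[of "x - y"] by simp
  from p.linear_independent_extend[OF this, of "\<lambda>_. 1"]
  obtain g where g: "Vector_Spaces.linear s (*) g" "g (x - y) = 1" by auto
  then have "g \<in> dual s" by (simp add: dual_def)
  then have "g x = g (x - y) + g y" "g x = g y"
    using dual_add[of g s "x - y" y] assms(2)[of g] by simp_all
  with g show False by simp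
qed

lemma fun_sum_list2: "(\<Sum>p\<leftarrow>ps. f p) \<xi> \<eta> = (\<Sum>p\<leftarrow>ps. f p \<xi> \<eta>)"
  by (induction ps) simp_all

lemma fun_sum_list3: "(\<Sum>p\<leftarrow>ps. f p) \<xi> \<eta> \<zeta> = (\<Sum>p\<leftarrow>ps. f p \<xi> \<eta> \<zeta>)"
  by (induction ps) simp_all

lemma tensor_of_apply:
  assumes "\<xi> \<in> dual s" "\<eta> \<in> dual s"
  shows "tensor_of s ps \<xi> \<eta> = (\<Sum>(a, b)\<leftarrow>ps. \<xi> a * \<eta> b)"
  using assms
  by (simp add: tensor_of_def fun_sum_list2 pure2_def form2_def split_def)

lemma r_plus_tensor_of:
  assumes "vector_space s" "\<xi> \<in> dual s"
  shows "r_plus s (tensor_of s ps) \<xi> = (\<Sum>(a, b)\<leftarrow>ps. s (\<xi> a) b)"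
  unfolding r_plus_def
proof (rule the_equality)
  show *: "\<forall>\<eta>\<in>dual s. \<eta> (\<Sum>(a, b)\<leftarrow>ps. s (\<xi> a) b) = tensor_of s ps \<xi> \<eta>"
    using assms by (auto simp: tensor_of_apply dual_sum_list dual_scale_apply split_def)
  show "x = (\<Sum>(a, b)\<leftarrow>ps. s (\<xi> a) b)" if "\<forall>\<eta>\<in>dual s. \<eta> x = tensor_of s ps \<xi> \<eta>" for x
    using that * by (intro dual_separates[OF assms(1)]) simp
qed

lemma r_minus_tensor_of:
  assumes "vector_space s" "\<xi> \<in> dual s"
  shows "r_minus s (tensor_of s ps) \<xi> = (\<Sum>(a, b)\<leftarrow>ps. s (\<xi> b) a)"
  unfolding r_minus_def
proof (rule the_equality)
  show *: "\<forall>\<eta>\<in>dual s. \<eta> (\<Sum>(a, b)\<leftarrow>ps. s (\<xi> b) a) = tensor_of s ps \<eta> \<xi>"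
    using assms by (auto simp: tensor_of_apply dual_sum_list dual_scale_apply split_def mult.commute)
  show "x = (\<Sum>(a, b)\<leftarrow>ps. s (\<xi> b) a)" if "\<forall>\<eta>\<in>dual s. \<eta> x = tensor_of s ps \<eta> \<xi>" for x
    using that * by (intro dual_separates[OF assms(1)]) simp
qed

lemma map2_tensor_of:
  assumes "Vector_Spaces.linear s s f" "Vector_Spaces.linear s s g"
  shows "map2 s f g (tensor_of s ps) = tensor_of s (map (\<lambda>(a, b). (f a, g b)) ps)"
proof (intro ext)
  fix \<xi> \<eta> :: "'b \<Rightarrow> 'a"
  show "map2 s f g (tensor_of s ps) \<xi> \<eta> = tensor_of s (map (\<lambda>(a, b). (f a, g b)) ps) \<xi> \<eta>"
  proof (cases "\<xi> \<in> dual s \<and> \<eta> \<in> dual s")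
    case True
    then have "\<xi> \<circ> f \<in> dual s" "\<eta> \<circ> g \<in> dual s"
      using assms by (auto simp: dual_def Vector_Spaces.linear_iff)
    with True show ?thesis
      by (simp add: map2_def form2_def tensor_of_apply split_def o_def)
  next
    case False
    then show ?thesis
      by (auto simp: map2_def form2_def tensor_of_def fun_sum_list2 pure2_def split_def o_def)
  qed
qed

lemma bilinear_sum_list:
  assumes m: "mock_pre_Lie_algebra s UNIV m" and \<xi>: "\<xi> \<in> dual s"
  shows "\<xi> (m (\<Sum>p\<leftarrow>ps. s (f p) (u p)) (\<Sum>q\<leftarrow>qs. s (g q) (v q))) =
    (\<Sum>p\<leftarrow>ps. \<Sum>q\<leftarrow>qs. f p * g q * \<xi> (m (u p) (v q)))"
proof -
  have *: "m (x + x') y = m x y + m x' y" "m x (y + y') = m x y + m x y'"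
    "m (s c x) y = s c (m x y)" "m x (s c y) = s c (m x y)" for x x' y y' c
    using m by (auto simp: mock_pre_Lie_algebra_def linear_on_def)
  have z: "m 0 y = 0" "m x 0 = 0" for x y
    using *(1)[of 0 0 y] *(2)[of x 0 0] by simp_all
  have 1: "\<xi> (m x (\<Sum>q\<leftarrow>qs. s (g q) (v q))) = (\<Sum>q\<leftarrow>qs. g q * \<xi> (m x (v q)))" for x
    by (induction qs) (simp_all add: * z \<xi> dual_add[OF \<xi>] dual_scale_apply[OF \<xi>] dual_zero[OF \<xi>])
  show ?thesis
    by (induction ps)
      (simp_all add: * z dual_add[OF \<xi>] dual_scale_apply[OF \<xi>] dual_zero[OF \<xi>] 1
        sum_list_const_mult mult.assoc)
qed

lemma sum_list_swap:
  fixes f :: "'a \<Rightarrow> 'b \<Rightarrow> 'c::comm_monoid_add"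
  shows "(\<Sum>p\<leftarrow>ps. \<Sum>q\<leftarrow>qs. f p q) = (\<Sum>q\<leftarrow>qs. \<Sum>p\<leftarrow>ps. f p q)"
  by (induction ps) (simp_all add: sum_list_addf)

lemma bracket_of_apply:
  fixes s :: "'k::field \<Rightarrow> 'g::ab_group_add \<Rightarrow> 'g" and ps :: "('g \<times> 'g) list"
  assumes m: "mock_pre_Lie_algebra s UNIV m"
    and d: "\<xi> \<in> dual s" "\<eta> \<in> dual s" "\<zeta> \<in> dual s"
  defines "P \<equiv> r_plus s (tensor_of s ps)" and "M \<equiv> r_minus s (tensor_of s ps)"
  shows "bracket_of s m ps \<xi> \<eta> \<zeta> =
    - \<xi> (m (M \<zeta>) (M \<eta>)) - \<eta> (m (M \<zeta>) (M \<xi>))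
    + \<eta> (anticomm m (M \<zeta>) (P \<xi>)) + \<xi> (anticomm m (M \<zeta>) (P \<eta>))
    - \<zeta> (anticomm m (P \<xi>) (P \<eta>))"
proof -
  have vs: "vector_space s"
    using m by (simp add: mock_pre_Lie_algebra_def fin_dim_space_def)
  note b = bilinear_sum_list[OF m]
  have "bracket_of s m ps \<xi> \<eta> \<zeta> =
    (\<Sum>p\<leftarrow>ps. \<Sum>q\<leftarrow>ps.
       - (\<zeta> (snd p) * \<eta> (snd q) * \<xi> (m (fst p) (fst q)))
       - (\<zeta> (snd p) * \<xi> (snd q) * \<eta> (m (fst p) (fst q)))
       + (\<zeta> (snd p) * \<xi> (fst q) * \<eta> (m (fst p) (snd q)))
       + (\<zeta> (snd p) * \<xi> (fst q) * \<eta> (m (snd q) (fst p)))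
       + (\<zeta> (snd p) * \<eta> (fst q) * \<xi> (m (fst p) (snd q)))
       + (\<zeta> (snd p) * \<eta> (fst q) * \<xi> (m (snd q) (fst p)))
       - (\<xi> (fst p) * \<eta> (fst q) * \<zeta> (m (snd p) (snd q)))
       - (\<xi> (fst p) * \<eta> (fst q) * \<zeta> (m (snd q) (snd p))))"
    using d by (simp add: bracket_of_def fun_sum_list3 split_def pure3_def form3_def anticomm_def
        dual_add algebra_simps)
  also have "\<dots> = - \<xi> (m (M \<zeta>) (M \<eta>)) - \<eta> (m (M \<zeta>) (M \<xi>))
    + \<eta> (m (M \<zeta>) (P \<xi>)) + \<eta> (m (P \<xi>) (M \<zeta>)) + \<xi> (m (M \<zeta>) (P \<eta>)) + \<xi> (m (P \<eta>) (M \<zeta>))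
    - \<zeta> (m (P \<xi>) (P \<eta>)) - \<zeta> (m (P \<eta>) (P \<xi>))"
  proof -
    have P: "P \<chi> = (\<Sum>p\<leftarrow>ps. s (\<chi> (fst p)) (snd p))"
      and M: "M \<chi> = (\<Sum>p\<leftarrow>ps. s (\<chi> (snd p)) (fst p))" if "\<chi> \<in> dual s" for \<chi>
      using that by (simp_all add: P_def M_def r_plus_tensor_of[OF vs] r_minus_tensor_of[OF vs] split_def)
    have swap: "(\<Sum>p\<leftarrow>ps. \<Sum>q\<leftarrow>ps. f p * g q * h p q) = (\<Sum>p\<leftarrow>ps. \<Sum>q\<leftarrow>ps. g p * f q * h q p)"
      for f g :: "'g \<times> 'g \<Rightarrow> 'k" and h
      by (subst sum_list_swap) (simp only: mult.commute[of "f _" "g _"])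
    have 1: "\<eta> (m (P \<xi>) (M \<zeta>)) =
        (\<Sum>p\<leftarrow>ps. \<Sum>q\<leftarrow>ps. \<zeta> (snd p) * \<xi> (fst q) * \<eta> (m (snd q) (fst p)))"
      "\<xi> (m (P \<eta>) (M \<zeta>)) =
        (\<Sum>p\<leftarrow>ps. \<Sum>q\<leftarrow>ps. \<zeta> (snd p) * \<eta> (fst q) * \<xi> (m (snd q) (fst p)))"
      "\<zeta> (m (P \<eta>) (P \<xi>)) =
        (\<Sum>p\<leftarrow>ps. \<Sum>q\<leftarrow>ps. \<xi> (fst p) * \<eta> (fst q) * \<zeta> (m (snd q) (snd p)))"
      unfolding P[OF d(1)] P[OF d(2)] M[OF d(3)] b[OF d(1)] b[OF d(2)] b[OF d(3)] by (rule swap)+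
    have neg: "(\<Sum>p\<leftarrow>ps. - f p) = - (\<Sum>p\<leftarrow>ps. f p)" for f :: "'g \<times> 'g \<Rightarrow> 'k"
      by (induction ps) simp_all
    show ?thesis
      unfolding 1 by (simp only: P M d b[OF d(1)] b[OF d(2)] b[OF d(3)] sum_list_addf sum_list_subtractf neg)
  qed
  finally show ?thesis
    using d by (simp add: anticomm_def dual_add)
qed

lemma bracket_tensor_of:
  assumes m: "mock_pre_Lie_algebra s UNIV m"
  shows "bracket s m (tensor_of s ps) = bracket_of s m ps"
proof -
  define qs where "qs = (SOME qs. tensor_of s qs = tensor_of s ps)"
  have qs: "tensor_of s qs = tensor_of s ps"
    unfolding qs_def by (rule someI[of _ ps]) simp
  have "bracket_of s m qs \<xi> \<eta> \<zeta> = bracket_of s m ps \<xi> \<eta> \<zeta>" for \<xi> \<eta> \<zeta>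
  proof (cases "\<xi> \<in> dual s \<and> \<eta> \<in> dual s \<and> \<zeta> \<in> dual s")
    case True
    then show ?thesis by (simp add: bracket_of_apply[OF m] qs)
  next
    case False
    then show ?thesis
      by (auto simp: bracket_of_def fun_sum_list3 split_def pure3_def form3_def)
  qed
  then show ?thesis unfolding bracket_def qs_def by (intro ext)
qed

end

theory Submission
  imports Defs
begin

text \<open>
  Write \<open>P = r\<^sub>+\<close>, \<open>M = r\<^sub>-\<close>, \<open>I = P - M\<close>. Invariance of the skew-symmetric part of \<open>r\<close> says that
  \<open>\<eta>({x, I \<xi>}) = - \<xi>(x \<cdot> I \<eta>)\<close>, and implies \<open>I(R\<^sub>x\<^sup>* \<xi>) = I \<xi> \<cdot> x\<close>; with it, the axioms of an action on
  \<open>(\<gg>\<^sup>*, \<cdot>\<^sub>+)\<close> become instances of the mock-pre-Lie identity of \<open>\<gg>\<close>. Paired with \<open>\<zeta>\<close>, the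
  Rota-Baxter identity is the vanishing of
  \<open>T(\<xi>, \<eta>, \<zeta>) = \<zeta>(P \<xi> \<cdot> P \<eta>) - \<eta>({P \<xi>, M \<zeta>}) + \<xi>(M \<zeta> \<cdot> M \<eta>)\<close>. The equation \<open>[[r, r]] = 0\<close> only says
  that \<open>T\<close> is skew in \<open>\<xi>, \<eta>\<close>, but by invariance \<open>T\<close> is symmetric in \<open>\<xi>, \<zeta>\<close>. All transpositions are
  conjugate, so a form with both properties is zero.
\<close>

section \<open>The dual as a finite-dimensional space\<close>

lemma vector_space_dual_scale: "vector_space (dual_scale :: 'k::field \<Rightarrow> ('g \<Rightarrow> 'k) \<Rightarrow> _)"
  by unfold_locales (auto simp: dual_scale_def algebra_simps fun_eq_iff)

lemma subspace_dual:
  assumes "vector_space s"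
  shows "module.subspace dual_scale (dual s)"
proof -
  interpret d: vector_space dual_scale by (rule vector_space_dual_scale)
  show ?thesis
    unfolding d.subspace_def using assms
    by (auto simp: dual_def Vector_Spaces.linear_iff dual_scale_def algebra_simps
        Vector_Spaces.vector_space_def)
qed

text \<open>A finite spanning set contains a basis \<open>B\<close>, and the coordinate functionals
  \<open>c b\<close> span the dual: \<open>\<xi>\<close> is the sum of the \<open>c b\<close> with
  coefficients \<open>\<xi> b\<close>.\<close>

lemma fin_dim_space_dual:
  fixes s :: "'k::field \<Rightarrow> 'g::ab_group_add \<Rightarrow> 'g"
  assumes "fin_dim_space s UNIV"
  shows "fin_dim_space dual_scale (dual s)"
proof -
  have vs: "vector_space s" using assms by (simp add: fin_dim_space_def)
  interpret v: vector_space s by fact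
  interpret d: vector_space "dual_scale :: 'k \<Rightarrow> ('g \<Rightarrow> 'k) \<Rightarrow> _"
    by (rule vector_space_dual_scale)
  interpret vp: vector_space_pair s "(*) :: 'k \<Rightarrow> 'k \<Rightarrow> 'k"
    by (intro vector_space_pair.intro vs, unfold_locales) (simp_all add: algebra_simps)
  obtain S where S: "finite S" "v.span S = UNIV"
    using assms by (auto simp: fin_dim_space_def)
  obtain B where B: "B \<subseteq> S" "v.independent B" "S \<subseteq> v.span B"
    using v.maximal_independent_subset[of S] by blast
  have fB: "finite B" using B(1) S(1) by (rule finite_subset)
  have sB: "v.span B = UNIV" using B(3) S(2) v.span_mono v.span_span by blast
  define c where "c b = (\<lambda>x. v.representation B x b)" for b
  have c: "c b \<in> dual s" for b
    unfolding dual_def c_def using vs B(2) sB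
    by (simp add: Vector_Spaces.linear_iff v.representation_add v.representation_scale
        vp.vs2.vector_space_axioms)
  have "d.span (c ` B) = dual s"
  proof
    show "d.span (c ` B) \<subseteq> dual s"
      using c by (intro d.span_minimal subspace_dual vs) auto
    show "dual s \<subseteq> d.span (c ` B)"
    proof
      fix \<xi> assume \<xi>: "\<xi> \<in> dual s"
      then interpret x: Vector_Spaces.linear s "(*)" \<xi> by (simp add: dual_def)
      have "\<xi> x = (\<Sum>b\<in>B. dual_scale (\<xi> b) (c b)) x" for x
      proof -
        have "x = (\<Sum>b\<in>B. s (c b x) b)"
          using v.sum_representation_eq[OF B(2), of x B] fB sB by (simp add: c_def)
        then have "\<xi> x = \<xi> (\<Sum>b\<in>B. s (c b x) b)" by (rule arg_cong)
        also have "\<dots> = (\<Sum>b\<in>B. c b x * \<xi> b)"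
          by (simp only: x.sum x.scale)
        also have "\<dots> = (\<Sum>b\<in>B. dual_scale (\<xi> b) (c b) x)"
          by (simp add: dual_scale_def mult.commute)
        also have "\<dots> = (\<Sum>b\<in>B. dual_scale (\<xi> b) (c b)) x"
          using fB by (induction B rule: finite_induct) simp_all
        finally show ?thesis .
      qed
      then have "\<xi> = (\<Sum>b\<in>B. dual_scale (\<xi> b) (c b))" by (rule ext)
      also have "\<dots> \<in> d.span (c ` B)"
        by (intro d.span_sum d.span_scale d.span_base imageI)
      finally show "\<xi> \<in> d.span (c ` B)" .
    qed
  qed
  then show ?thesis
    unfolding fin_dim_space_def
    using fB vector_space_dual_scale subspace_dual[OF vs] by blast
qed

section \<open>Bilinearity and closure of the dual under the operators\<close>

locale quasi_triangular_mock_pre_Lie =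
  fixes s :: "'k::field_char_0 \<Rightarrow> 'g::ab_group_add \<Rightarrow> 'g"
    and m :: "'g \<Rightarrow> 'g \<Rightarrow> 'g"
    and r :: "('g \<Rightarrow> 'k) \<Rightarrow> ('g \<Rightarrow> 'k) \<Rightarrow> 'k"
  assumes alg: "mock_pre_Lie_algebra s UNIV m"
    and tensor: "r \<in> tensors s"
    and quasi: "quasi_triangular s m r"
begin

abbreviation "P \<equiv> r_plus s r"
abbreviation "M \<equiv> r_minus s r"
abbreviation "I \<equiv> I_map s r"
abbreviation "mu \<equiv> R_star m"
abbreviation "rho \<equiv> \<lambda>x \<xi>. - L_star m x \<xi> - R_star m x \<xi>"
abbreviation "pp \<equiv> plus_product s m r"

lemma vs: "vector_space s"
  using alg by (simp add: mock_pre_Lie_algebra_def fin_dim_space_def)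

lemma bilinear:
  "m (x + x') y = m x y + m x' y" "m x (y + y') = m x y + m x y'"
  "m (s c x) y = s c (m x y)" "m x (s c y) = s c (m x y)"
  using alg by (auto simp: mock_pre_Lie_algebra_def linear_on_def)

lemma bilinear_diff: "m (x - x') y = m x y - m x' y" "m x (y - y') = m x y - m x y'"
  using bilinear(1)[of "x - x'" x' y] bilinear(2)[of x "y - y'" y'] by (simp_all add: eq_diff_eq)

lemma mock_pre_Lie: "m (m x y) z + m x (m y z) + m (m y x) z + m y (m x z) = 0"
proof -
  have "m (m x y) z + m x (m y z) = - m (m y x) z - m y (m x z)"
    using alg by (simp add: mock_pre_Lie_algebra_def)
  then show ?thesis by simp
qed

lemma dual_diff: "\<xi> \<in> dual s \<Longrightarrow> \<xi> (x - y) = \<xi> x - \<xi> y"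
  using dual_add[of \<xi> s "x - y" y] by (simp add: eq_diff_eq)

lemma dual_mock_pre_Lie:
  assumes "\<xi> \<in> dual s"
  shows "\<xi> (m (m x y) z) + \<xi> (m x (m y z)) + \<xi> (m (m y x) z) + \<xi> (m y (m x z)) = 0"
  using arg_cong[OF mock_pre_Lie[of x y z], of \<xi>] assms by (simp add: dual_add dual_zero)

lemma dual_closed:
  "\<xi> \<in> dual s \<Longrightarrow> \<eta> \<in> dual s \<Longrightarrow> \<xi> + \<eta> \<in> dual s"
  "\<xi> \<in> dual s \<Longrightarrow> \<eta> \<in> dual s \<Longrightarrow> \<xi> - \<eta> \<in> dual s"
  "\<xi> \<in> dual s \<Longrightarrow> - \<xi> \<in> dual s"
  "\<xi> \<in> dual s \<Longrightarrow> dual_scale c \<xi> \<in> dual s"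
  "\<xi> \<in> dual s \<Longrightarrow> (\<lambda>y. \<xi> (m x y)) \<in> dual s"
  "\<xi> \<in> dual s \<Longrightarrow> (\<lambda>y. \<xi> (m y x)) \<in> dual s"
  by (auto simp: dual_def Vector_Spaces.linear_iff dual_scale_def bilinear algebra_simps)

lemma mu_apply: "mu x \<xi> y = - \<xi> (m y x)"
  by (simp add: R_star_def)

lemma rho_apply: "rho x \<xi> y = \<xi> (m x y) + \<xi> (m y x)"
  by (simp add: R_star_def L_star_def)

lemma pp_apply: "pp \<xi> \<eta> y = - \<xi> (m y (I \<eta>))"
  by (simp add: plus_product_def R_star_def)

lemma mu_dual: "\<xi> \<in> dual s \<Longrightarrow> mu x \<xi> \<in> dual s"
  using dual_closed(3)[OF dual_closed(6), of \<xi> x] by (simp add: R_star_def fun_Compl_def)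

lemma rho_dual: "\<xi> \<in> dual s \<Longrightarrow> rho x \<xi> \<in> dual s"
proof -
  have "rho x \<xi> = (\<lambda>y. \<xi> (m x y)) + (\<lambda>y. \<xi> (m y x))"
    by (rule ext) (simp add: R_star_def L_star_def)
  then show "\<xi> \<in> dual s \<Longrightarrow> rho x \<xi> \<in> dual s" by (simp add: dual_closed)
qed

lemma pp_dual: "\<xi> \<in> dual s \<Longrightarrow> pp \<xi> \<eta> \<in> dual s"
  by (simp add: plus_product_def mu_dual)

section \<open>The maps \<open>P\<close>, \<open>M\<close> and \<open>I\<close> as operators on the
  dual\<close>

lemma P_M_pairing:
  assumes "\<xi> \<in> dual s" "\<eta> \<in> dual s"
  shows P_pairing: "\<eta> (P \<xi>) = r \<xi> \<eta>" and M_pairing: "\<eta> (M \<xi>) = r \<eta> \<xi>"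
proof -
  \<comment> \<open>\<open>r_plus\<close> and \<open>r_minus\<close> are definite descriptions; a
    presentation of \<open>r\<close> supplies the vectors they denote.\<close>
  obtain ps where ps: "r = tensor_of s ps" using tensor by (auto simp: tensors_def)
  show "\<eta> (P \<xi>) = r \<xi> \<eta>"
    unfolding ps using assms vs
    by (simp add: r_plus_tensor_of tensor_of_apply dual_sum_list dual_scale_apply split_def)
  show "\<eta> (M \<xi>) = r \<eta> \<xi>"
    unfolding ps using assms vs
    by (simp add: r_minus_tensor_of tensor_of_apply dual_sum_list dual_scale_apply split_def
        mult.commute)
qed

lemma P_M_swap: "\<xi> \<in> dual s \<Longrightarrow> \<eta> \<in> dual s \<Longrightarrow> \<eta> (P \<xi>) = \<xi> (M \<eta>)"
  by (simp add: P_pairing M_pairing)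

lemma I_pairing: "\<xi> \<in> dual s \<Longrightarrow> \<eta> \<in> dual s \<Longrightarrow> \<eta> (I \<xi>) = r \<xi> \<eta> - r \<eta> \<xi>"
  by (simp add: I_map_def dual_diff P_pairing M_pairing)

lemma I_skew: "\<xi> \<in> dual s \<Longrightarrow> \<eta> \<in> dual s \<Longrightarrow> \<eta> (I \<xi>) = - \<xi> (I \<eta>)"
  by (simp add: I_pairing)

lemma separates: "(\<And>\<xi>. \<xi> \<in> dual s \<Longrightarrow> \<xi> x = \<xi> y) \<Longrightarrow> x = y"
  using dual_separates[OF vs] by blast

text \<open>\<open>P\<close> and \<open>M\<close> are transposes of each other: tested against
  \<open>\<zeta>\<close>, \<open>P \<xi>\<close> gives \<open>\<xi> (M \<zeta>)\<close>, which is
  visibly linear in \<open>\<xi>\<close>. Skewness of \<open>I\<close> gives its linearity in the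
  same way.\<close>

lemma P_linear:
  assumes "\<xi> \<in> dual s"
  shows P_add: "\<eta> \<in> dual s \<Longrightarrow> P (\<xi> + \<eta>) = P \<xi> + P \<eta>"
    and P_scale: "P (dual_scale c \<xi>) = s c (P \<xi>)"
proof -
  show "P (\<xi> + \<eta>) = P \<xi> + P \<eta>" if "\<eta> \<in> dual s"
    using that assms
    by (intro separates) (simp add: P_M_swap dual_closed dual_add)
  show "P (dual_scale c \<xi>) = s c (P \<xi>)"
    using assms
    by (intro separates) (simp add: P_M_swap dual_closed dual_scale_apply, simp add: dual_scale_def)
qed

lemma I_linear:
  assumes "\<xi> \<in> dual s"
  shows I_add: "\<eta> \<in> dual s \<Longrightarrow> I (\<xi> + \<eta>) = I \<xi> + I \<eta>"
    and I_scale: "I (dual_scale c \<xi>) = s c (I \<xi>)"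
proof -
  show "I (\<xi> + \<eta>) = I \<xi> + I \<eta>" if "\<eta> \<in> dual s"
  proof (rule separates)
    fix \<zeta> assume "\<zeta> \<in> dual s"
    then show "\<zeta> (I (\<xi> + \<eta>)) = \<zeta> (I \<xi> + I \<eta>)"
      using that assms by (simp add: I_skew[of _ \<zeta>] dual_closed dual_add)
  qed
  show "I (dual_scale c \<xi>) = s c (I \<xi>)"
  proof (rule separates)
    fix \<zeta> assume "\<zeta> \<in> dual s"
    then show "\<zeta> (I (dual_scale c \<xi>)) = \<zeta> (s c (I \<xi>))"
      using assms
      by (simp add: I_skew[of _ \<zeta>] dual_closed dual_scale_apply) (simp add: dual_scale_def)
  qed
qed

section \<open>Consequences of invariance\<close>

lemma I_invariant:
  assumes "\<xi> \<in> dual s" "\<eta> \<in> dual s"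
  shows "\<eta> (m x (I \<xi>)) + \<eta> (m (I \<xi>) x) = - \<xi> (m x (I \<eta>))"
proof -
  have d: "(\<lambda>y. \<xi> (m x y)) \<in> dual s" "(\<lambda>y. \<eta> (m x y + m y x)) \<in> dual s"
    using assms by (auto simp: dual_def Vector_Spaces.linear_iff bilinear algebra_simps)
  have "map2 s (m x) id (skew_part r) - map2 s id (\<lambda>y. m x y + m y x) (skew_part r) = 0"
    using quasi unfolding quasi_triangular_def L_LR_invariant_def by blast
  from fun_cong[OF fun_cong[OF this, of \<xi>], of \<eta>]
  have "(r (\<lambda>y. \<xi> (m x y)) \<eta> - r \<eta> (\<lambda>y. \<xi> (m x y))) / 2 =
      (r \<xi> (\<lambda>y. \<eta> (m x y + m y x)) - r (\<lambda>y. \<eta> (m x y + m y x)) \<xi>) / 2"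
    using assms by (simp add: map2_def form2_def skew_part_def o_def)
  \<comment> \<open>The factor 1/2 of the skew part cancels, as 2 is nonzero in characteristic
    0.\<close>
  then have "r (\<lambda>y. \<xi> (m x y)) \<eta> - r \<eta> (\<lambda>y. \<xi> (m x y)) =
      r \<xi> (\<lambda>y. \<eta> (m x y + m y x)) - r (\<lambda>y. \<eta> (m x y + m y x)) \<xi>"
    by (simp only: divide_cancel_right) simp
  \<comment> \<open>The skew part at \<open>\<xi>\<close>, \<open>\<eta>\<close> is half of
    \<open>\<eta> (I \<xi>)\<close>, so both sides are values of functionals on the image of
    \<open>I\<close>; skewness of \<open>I\<close> then frees its argument from
    \<open>x\<close>.\<close>
  then have "\<eta> (I (\<lambda>y. \<xi> (m x y))) = \<eta> (m x (I \<xi>) + m (I \<xi>) x)"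
    using I_pairing[OF d(1) assms(2)] I_pairing[OF assms(1) d(2)] by simp
  moreover have "\<eta> (I (\<lambda>y. \<xi> (m x y))) = - \<xi> (m x (I \<eta>))"
    using d(1) assms(2) by (rule I_skew)
  ultimately show ?thesis
    using assms by (simp add: dual_add)
qed

text \<open>By invariance both sides equal
  \<open>- \<xi> (m x (I \<eta>)) - \<eta> (m x (I \<xi>))\<close>, which is symmetric in
  \<open>\<xi>\<close> and \<open>\<eta>\<close>.\<close>

lemma I_right_symmetric:
  assumes "\<xi> \<in> dual s" "\<eta> \<in> dual s"
  shows "\<eta> (m (I \<xi>) x) = \<xi> (m (I \<eta>) x)"
  using I_invariant[OF assms, of x] I_invariant[OF assms(2,1), of x] by algebra

lemma I_mu: "\<xi> \<in> dual s \<Longrightarrow> I (mu x \<xi>) = m (I \<xi>) x"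
proof (rule separates)
  fix \<eta> assume "\<xi> \<in> dual s" "\<eta> \<in> dual s"
  then show "\<eta> (I (mu x \<xi>)) = \<eta> (m (I \<xi>) x)"
    by (simp add: I_skew[of _ \<eta>] mu_dual I_right_symmetric[of \<xi> \<eta>] mu_apply)
qed

text \<open>Together with \<open>I_mu\<close>, this makes \<open>I\<close> intertwine the pair
  \<open>rho\<close>, \<open>mu\<close> with left and right multiplication on \<open>\<gg>\<close>,
  so that \<open>I\<close> disappears from the nested products in the action axioms.\<close>

lemma I_rho: "\<xi> \<in> dual s \<Longrightarrow> I (rho x \<xi>) = m x (I \<xi>)"
proof (rule separates)
  fix \<eta> assume d: "\<xi> \<in> dual s" "\<eta> \<in> dual s"
  have "\<eta> (I (rho x \<xi>)) = - rho x \<xi> (I \<eta>)"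
    using d by (intro I_skew rho_dual)
  also have "\<dots> = \<eta> (m x (I \<xi>))"
    using I_invariant[OF d(2,1), of x] by (simp only: rho_apply minus_minus)
  finally show "\<eta> (I (rho x \<xi>)) = \<eta> (m x (I \<xi>))" .
qed

section \<open>The action on the dual\<close>

lemma action_mu:
  assumes "u \<in> dual s" "v \<in> dual s"
  shows "mu x (pp u v) + pp u (mu x v) + pp v (mu x u) + mu x (pp v u) = 0"
proof
  fix y
  \<comment> \<open>Invariance rewrites every term in \<open>v\<close> as terms in \<open>u\<close>;
    what remains is, up to sign, the identity of \<open>\<gg>\<close> for \<open>y\<close>,
    \<open>I v\<close>, \<open>x\<close>, paired with \<open>u\<close>.\<close>
  have 1: "v (m (m y x) (I u)) = - u (m (m y x) (I v)) - u (m (I v) (m y x))"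
    using I_invariant[OF assms(2,1), of "m y x"] by algebra
  \<comment> \<open>Invariance is applied to \<open>mu x u\<close> in place of \<open>u\<close>,
    since \<open>I\<close> maps it to \<open>m (I u) x\<close>.\<close>
  have "- u (m (m y (I v)) x) - u (m (m (I v) y) x) = - v (m y (m (I u) x))"
    using I_invariant[OF assms(2) mu_dual[OF assms(1)], of x y] I_mu[OF assms(1), of x]
    by (simp add: mu_apply)
  then have 2: "v (m y (m (I u) x)) = u (m (m y (I v)) x) + u (m (m (I v) y) x)" by algebra
  have "(mu x (pp u v) + pp u (mu x v) + pp v (mu x u) + mu x (pp v u)) y =
      u (m (m y x) (I v)) - u (m y (m (I v) x)) - v (m y (m (I u) x)) + v (m (m y x) (I u))"
    using assms by (simp add: mu_apply pp_apply I_mu)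
  also have "\<dots> = 0"
    unfolding 1 2 using dual_mock_pre_Lie[OF assms(1), of y "I v" x] by algebra
  finally show "(mu x (pp u v) + pp u (mu x v) + pp v (mu x u) + mu x (pp v u)) y = 0 y"
    by simp
qed

lemma action_rho:
  assumes "u \<in> dual s" "v \<in> dual s"
  shows "pp (mu x u) v + pp u (rho x v) + pp (rho x u) v + rho x (pp u v) = 0"
proof
  fix y
  have "(pp (mu x u) v + pp u (rho x v) + pp (rho x u) v + rho x (pp u v)) y =
      pp (mu x u) v y + pp u (rho x v) y + pp (rho x u) v y + rho x (pp u v) y" by simp
  also have "\<dots> = 0"
    \<comment> \<open>The terms \<open>u (m (m y (I v)) x)\<close> cancel, leaving minus the
      identity for \<open>x\<close>, \<open>y\<close>, \<open>I v\<close>.\<close>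
    unfolding pp_apply rho_apply mu_apply I_rho[OF assms(2)]
    using dual_mock_pre_Lie[OF assms(1), of x y "I v"] by algebra
  finally show "(pp (mu x u) v + pp u (rho x v) + pp (rho x u) v + rho x (pp u v)) y = 0 y"
    by simp
qed

lemma mock_pre_Lie_algebra_pp: "mock_pre_Lie_algebra dual_scale (dual s) pp"
  unfolding mock_pre_Lie_algebra_def
proof (intro conjI ballI)
  show "fin_dim_space dual_scale (dual s)"
    using alg by (intro fin_dim_space_dual) (simp add: mock_pre_Lie_algebra_def)
next
  fix \<xi> assume \<xi>: "\<xi> \<in> dual s"
  show "linear_on dual_scale (dual s) dual_scale (dual s) (pp \<xi>)"
    using \<xi> by (auto simp: linear_on_def pp_dual fun_eq_iff pp_apply I_add I_scale bilinear dual_add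
        dual_scale_apply, simp_all add: dual_scale_def pp_apply)
  show "linear_on dual_scale (dual s) dual_scale (dual s) (\<lambda>\<eta>. pp \<eta> \<xi>)"
    by (auto simp: linear_on_def pp_dual fun_eq_iff pp_apply dual_scale_def)
next
  fix \<xi> \<eta> \<zeta> assume d: "\<xi> \<in> dual s" "\<eta> \<in> dual s" "\<zeta> \<in> dual s"
  show "pp (pp \<xi> \<eta>) \<zeta> + pp \<xi> (pp \<eta> \<zeta>) = - pp (pp \<eta> \<xi>) \<zeta> - pp \<eta> (pp \<xi> \<zeta>)"
    \<comment> \<open>Since \<open>pp \<xi> \<zeta>\<close> is \<open>mu (I \<zeta>) \<xi>\<close>,
      the mock-pre-Lie identity is the first action axiom at \<open>x = I \<zeta>\<close>.\<close>
    using action_mu[OF d(1,2), of "I \<zeta>"]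
    by (simp add: plus_product_def algebra_simps eq_neg_iff_add_eq_0)
qed

lemma mock_pre_Lie_rep_dual:
  "mock_pre_Lie_rep s UNIV m dual_scale (dual s) rho mu"
  unfolding mock_pre_Lie_rep_def
proof (intro conjI ballI)
  show "mock_pre_Lie_algebra s UNIV m" by (rule alg)
  show "fin_dim_space dual_scale (dual s)"
    using alg by (intro fin_dim_space_dual) (simp add: mock_pre_Lie_algebra_def)
next
  fix x
  show "linear_on dual_scale (dual s) dual_scale (dual s) (rho x)"
    unfolding linear_on_def using rho_dual[of _ x]
    by (auto simp: fun_eq_iff L_star_def R_star_def dual_scale_def algebra_simps)
  show "linear_on dual_scale (dual s) dual_scale (dual s) (mu x)"
    unfolding linear_on_def
    by (auto simp: mu_dual fun_eq_iff mu_apply dual_scale_def)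
next
  fix \<xi> assume \<xi>: "\<xi> \<in> dual s"
  show "linear_on s UNIV dual_scale (dual s) (\<lambda>x. rho x \<xi>)"
    unfolding linear_on_def using rho_dual[OF \<xi>]
    by (auto simp: fun_eq_iff L_star_def R_star_def bilinear dual_add[OF \<xi>] dual_scale_apply[OF \<xi>]
        dual_scale_def algebra_simps)
  show "linear_on s UNIV dual_scale (dual s) (\<lambda>x. mu x \<xi>)"
    unfolding linear_on_def using mu_dual[OF \<xi>]
    by (auto simp: fun_eq_iff mu_apply bilinear dual_add[OF \<xi>] dual_scale_apply[OF \<xi>] dual_scale_def)
next
  fix x y \<xi> assume \<xi>: "\<xi> \<in> dual s"
  show "rho (anticomm m x y) \<xi> = - rho x (rho y \<xi>) - rho y (rho x \<xi>)"
  proof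
    fix z
    show "rho (anticomm m x y) \<xi> z = (- rho x (rho y \<xi>) - rho y (rho x \<xi>)) z"
      \<comment> \<open>\<open>rho x\<close> is the transpose of \<open>anticomm m x\<close>, so the
        claim is the Jacobi identity for the anticommutator: the sum of the three cyclic instances
        of the mock-pre-Lie identity.\<close>
      using arg_cong2[of _ _ _ _ "(+)", OF arg_cong2[of _ _ _ _ "(+)",
          OF dual_mock_pre_Lie[OF \<xi>, of x y z] dual_mock_pre_Lie[OF \<xi>, of y z x]]
          dual_mock_pre_Lie[OF \<xi>, of z x y]]
      by (simp add: L_star_def R_star_def anticomm_def bilinear dual_add[OF \<xi>])
        (simp add: algebra_simps eq_neg_iff_add_eq_0)
  qed
  show "rho x (mu y \<xi>) + mu y (rho x \<xi>) = - mu (m x y) \<xi> - mu y (mu x \<xi>)"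
  proof
    fix z
    show "(rho x (mu y \<xi>) + mu y (rho x \<xi>)) z = (- mu (m x y) \<xi> - mu y (mu x \<xi>)) z"
      using dual_mock_pre_Lie[OF \<xi>, of x z y]
      by (simp add: L_star_def R_star_def) (simp add: algebra_simps neg_eq_iff_add_eq_0)
  qed
qed

section \<open>The Rota-Baxter identity\<close>

definition T :: "('g \<Rightarrow> 'k) \<Rightarrow> ('g \<Rightarrow> 'k) \<Rightarrow> ('g \<Rightarrow> 'k) \<Rightarrow> 'k" where
  "T u v w = w (m (P u) (P v)) - v (anticomm m (P u) (M w)) + u (m (M w) (M v))"

text \<open>By \<open>bracket_of_apply\<close>, the value of the bracket at \<open>u\<close>,
  \<open>v\<close>, \<open>w\<close> is \<open>- (T u v w + T v u w)\<close>.\<close>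

lemma T_skew:
  assumes "u \<in> dual s" "v \<in> dual s" "w \<in> dual s"
  shows "T v u w = - T u v w"
proof -
  obtain ps where ps: "r = tensor_of s ps" using tensor by (auto simp: tensors_def)
  have "bracket_of s m ps u v w = 0"
    using quasi by (simp add: quasi_triangular_def ps bracket_tensor_of[OF alg])
  then show ?thesis
    unfolding bracket_of_apply[OF alg assms] ps[symmetric] T_def
    using assms by (simp add: anticomm_def dual_add algebra_simps)
qed

text \<open>Substituting \<open>M = P - I\<close>, except in one factor \<open>M v\<close>, and
  applying invariance makes all terms but \<open>u (m (I w) (M v))\<close> jointly symmetric in
  \<open>u\<close> and \<open>w\<close>; that last one is symmetric by
  \<open>I_right_symmetric\<close>.\<close>

lemma T_symmetric:
  assumes "u \<in> dual s" "v \<in> dual s" "w \<in> dual s"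
  shows "T w v u = T u v w"
proof -
  have "T u v w = w (m (P u) (P v)) + u (m (P w) (P v)) - v (anticomm m (P u) (P w))
      - w (m (P u) (I v)) - u (m (P w) (I v)) - u (m (I w) (M v))"
    if "u \<in> dual s" "w \<in> dual s" for u w
  proof -
    have "v (m (P u) (I w)) + v (m (I w) (P u)) = - w (m (P u) (I v))"
      using I_invariant that assms(2) by blast
    then show ?thesis
      using that assms(2)
      by (simp add: T_def anticomm_def I_map_def bilinear_diff dual_add dual_diff algebra_simps)
  qed
  note expand = this[OF assms(1,3)] this[OF assms(3,1)]
  show ?thesis
    unfolding expand using assms(2) I_right_symmetric[OF assms(1,3), of "M v"]
    by (simp add: anticomm_def dual_add algebra_simps)
qed

lemma T_zero:
  assumes "u \<in> dual s" "v \<in> dual s" "w \<in> dual s"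
  shows "T u v w = 0"
proof -
  \<comment> \<open>The two transpositions compose to a 3-cycle. Applying it three times restores
    the arguments after three sign changes, and 2 is invertible.\<close>
  have "T u v w = - T v u w" using assms(2,1,3) by (rule T_skew)
  also have "T v u w = T w u v" using assms(3,1,2) by (rule T_symmetric)
  also have "T w u v = - T u w v" using assms(1,3,2) by (rule T_skew)
  also have "T u w v = T v w u" using assms(2,3,1) by (rule T_symmetric)
  also have "T v w u = - T w v u" using assms(3,2,1) by (rule T_skew)
  also have "T w v u = T u v w" using assms by (rule T_symmetric)
  finally have "2 * T u v w = 0" by (simp add: eq_neg_iff_add_eq_0)
  then show ?thesis by simp
qed

lemma P_Rota_Baxter:
  assumes "u \<in> dual s" "v \<in> dual s"
  shows "m (P u) (P v) = P (rho (P u) v + mu (P v) u + dual_scale (- 1) (pp u v))"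
    (is "_ = P ?f")
proof (rule separates)
  fix w assume w: "w \<in> dual s"
  have "?f \<in> dual s" using assms by (intro dual_closed rho_dual mu_dual pp_dual)
  then have "w (P ?f) = ?f (M w)" using w by (rule P_M_swap)
  \<comment> \<open>The weight -1 term adds \<open>u (m (M w) (I v))\<close> to
    \<open>- u (m (M w) (P v))\<close>, which turns \<open>P v\<close> into
    \<open>M v\<close>.\<close>
  also have "\<dots> = v (anticomm m (P u) (M w)) - u (m (M w) (M v))"
    using assms
    by (simp add: L_star_def R_star_def pp_apply dual_scale_def anticomm_def I_map_def bilinear_diff
        dual_add dual_diff)
  also have "\<dots> = w (m (P u) (P v))"
    using T_zero[OF assms w] by (simp add: T_def algebra_simps)
  finally show "w (m (P u) (P v)) = w (P ?f)" ..
qed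

end

theorem theorem4p16:
  fixes s :: "'k::{alg_closed_field,field_char_0} \<Rightarrow> 'g::ab_group_add \<Rightarrow> 'g"
    and m :: "'g \<Rightarrow> 'g \<Rightarrow> 'g"
    and r :: "('g \<Rightarrow> 'k) \<Rightarrow> ('g \<Rightarrow> 'k) \<Rightarrow> 'k"
  assumes "mock_pre_Lie_algebra s UNIV m"
    and "r \<in> tensors s"
    and "quasi_triangular s m r"
  shows "relative_Rota_Baxter (-1)
    dual_scale (dual s) (plus_product s m r)
    s UNIV m
    (\<lambda>x \<xi>. - L_star m x \<xi> - R_star m x \<xi>) (R_star m)
    (r_plus s r)"
proof -
  interpret quasi_triangular_mock_pre_Lie s m r by unfold_locales fact+
  show ?thesis
    unfolding relative_Rota_Baxter_def mock_pre_Lie_action_def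
    by (intro conjI ballI mock_pre_Lie_algebra_pp mock_pre_Lie_rep_dual action_mu action_rho
        P_Rota_Baxter) (auto simp: linear_on_def P_add P_scale)
qed

end
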